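(* Let $(S,v)$ be a normed semigroup and $\phi:S\to S$ an endomorphism. If $T$ is a $\phi$-invariant normed subsemigroup of $(S,v)$, then $h_{\mathfrak S}(\phi)\ge h_{\mathfrak S}(\phi\restriction_T)$. Equality holds provided that $S$ is preordered, $\phi$ and $v$ are monotone and $T$ is cofinal in $S$.
   Context: A normed semigroup $(S,v)$ is a semigroup $(S,\cdot)$ with a function $v:S\to\mathbb R_{\ge0}$. Endomorphisms are contractive semigroup endomorphisms: $v(\phi(x))\le v(x)$ for all $x$. A normed subsemigroup is a subsemigroup with the restricted norm; it is $\phi$-invariant if $\phi$ maps it into itself. $S$ is a preordered semigroup if it carries a preorder $\le$ such that $x\le y$ implies $x\cdot z\le y\cdot z$ and $z\cdot x\le z\cdot y$ for all $x,y,z\in S$; $\phi$ (resp. $v$) is monotone if $x\le y$ implies $\phi(x)\le\phi(y)$ (resp. $v(x)\le v(y)$); $T\subseteq S$ is cofinal if for every $s\in S$ there is $t\in T$ with $s\le t$. For $x\in S$, $T_n(\phi,x)=x\cdot\phi(x)\cdots\phi^{n-1}(x)$, $h_{\mathfrak S}(\phi,x)=\limsup_{n\to\infty}\frac{v(T_n(\phi,x))}{n}$, and $h_{\mathfrak S}(\phi)=\sup_{x\in S}h_{\mathfrak S}(\phi,x)\in[0,\infty]$. *)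

theory Defs
  imports "HOL-Analysis.Analysis"
begin

text \<open>
  Semigroups are given by an explicit carrier, so that a subsemigroup is the same operation on a
  smaller carrier. The empty carrier is allowed.
\<close>

locale carrier_semigroup =
  fixes S :: "'a set" and opr :: "'a \<Rightarrow> 'a \<Rightarrow> 'a"
  assumes mult_closed: "\<lbrakk>x \<in> S; y \<in> S\<rbrakk> \<Longrightarrow> opr x y \<in> S"
    and mult_assoc: "\<lbrakk>x \<in> S; y \<in> S; z \<in> S\<rbrakk> \<Longrightarrow> opr (opr x y) z = opr x (opr y z)"

locale normed_semigroup = carrier_semigroup S opr
  for S :: "'a set" and opr :: "'a \<Rightarrow> 'a \<Rightarrow> 'a" +
  fixes v :: "'a \<Rightarrow> real"
  assumes norm_nonneg: "x \<in> S \<Longrightarrow> 0 \<le> v x"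

locale normed_semigroup_endo = normed_semigroup S opr v
  for S :: "'a set" and opr :: "'a \<Rightarrow> 'a \<Rightarrow> 'a" and v :: "'a \<Rightarrow> real" +
  fixes \<phi> :: "'a \<Rightarrow> 'a"
  assumes endo_closed: "x \<in> S \<Longrightarrow> \<phi> x \<in> S"
    and endo_mult: "\<lbrakk>x \<in> S; y \<in> S\<rbrakk> \<Longrightarrow> \<phi> (opr x y) = opr (\<phi> x) (\<phi> y)"
    and endo_contractive: "x \<in> S \<Longrightarrow> v (\<phi> x) \<le> v x"

locale preordered_semigroup = carrier_semigroup S opr
  for S :: "'a set" and opr :: "'a \<Rightarrow> 'a \<Rightarrow> 'a" +
  fixes le :: "'a \<Rightarrow> 'a \<Rightarrow> bool"
  assumes le_refl: "reflp_on S le"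
    and le_trans: "transp_on S le"
    and mult_right_mono: "\<lbrakk>x \<in> S; y \<in> S; z \<in> S; le x y\<rbrakk> \<Longrightarrow> le (opr x z) (opr y z)"
    and mult_left_mono: "\<lbrakk>x \<in> S; y \<in> S; z \<in> S; le x y\<rbrakk> \<Longrightarrow> le (opr z x) (opr z y)"

definition subsemigroup :: "'a set \<Rightarrow> 'a set \<Rightarrow> ('a \<Rightarrow> 'a \<Rightarrow> 'a) \<Rightarrow> bool" where
  "subsemigroup T S opr \<longleftrightarrow> T \<subseteq> S \<and> (\<forall>x\<in>T. \<forall>y\<in>T. opr x y \<in> T)"

definition cofinal_in :: "('a \<Rightarrow> 'a \<Rightarrow> bool) \<Rightarrow> 'a set \<Rightarrow> 'a set \<Rightarrow> bool" where
  "cofinal_in le T S \<longleftrightarrow> T \<subseteq> S \<and> (\<forall>s\<in>S. \<exists>t\<in>T. le s t)"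

text \<open>
  The product \<open>x \<cdot> \<phi> x \<cdots> (\<phi> ^^ (n - 1)) x\<close>, for \<open>n \<ge> 1\<close>. A semigroup has no empty product, so the value at
  \<open>0\<close> is junk; it does not influence the limit superior below.
\<close>

fun trajectory :: "('a \<Rightarrow> 'a \<Rightarrow> 'a) \<Rightarrow> ('a \<Rightarrow> 'a) \<Rightarrow> nat \<Rightarrow> 'a \<Rightarrow> 'a" where
  "trajectory opr \<phi> 0 x = x"
| "trajectory opr \<phi> (Suc 0) x = x"
| "trajectory opr \<phi> (Suc (Suc n)) x = opr (trajectory opr \<phi> (Suc n) x) ((\<phi> ^^ Suc n) x)"

definition entropy_at ::
    "('a \<Rightarrow> 'a \<Rightarrow> 'a) \<Rightarrow> ('a \<Rightarrow> real) \<Rightarrow> ('a \<Rightarrow> 'a) \<Rightarrow> 'a \<Rightarrow> ennreal" where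
  "entropy_at opr v \<phi> x = limsup (\<lambda>n. ennreal (v (trajectory opr \<phi> n x) / real n))"

text \<open>The supremum is taken in \<open>[0, \<infinity>]\<close>, so it is \<open>0\<close> for the empty carrier.\<close>

definition semigroup_entropy ::
    "'a set \<Rightarrow> ('a \<Rightarrow> 'a \<Rightarrow> 'a) \<Rightarrow> ('a \<Rightarrow> real) \<Rightarrow> ('a \<Rightarrow> 'a) \<Rightarrow> ennreal" where
  "semigroup_entropy S opr v \<phi> = (SUP x\<in>S. entropy_at opr v \<phi> x)"

end

theory Submission
  imports Defs
begin

text \<open>For x in T all iterates of x, hence all partial products, stay in T, so the entropy at x
  is the same number in T as in S (\<open>entropy_at_restrict\<close>). Both global entropies are
  therefore suprema of one function x \<mapsto> \<open>entropy_at opr v \<phi> x\<close>, and the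
  inequality is just T \<subseteq> S. For equality, compatibility of the preorder with products and
  monotonicity of \<phi> and v make this function monotone (\<open>trajectory_mono\<close>,
  \<open>entropy_at_mono\<close>); cofinality puts above each x in S some t in T, whose entropy
  bounds that of x.\<close>

text \<open>\<open>restrict\<close> is \<open>undefined\<close> off T, but by invariance the orbit
  of x never leaves T, so that value is never met.\<close>

lemma funpow_restrict:
  assumes "f ` T \<subseteq> T" and "x \<in> T"
  shows "(restrict f T ^^ n) x = (f ^^ n) x"
proof (induction n)
  case (Suc n)
  have "(f ^^ n) x \<in> T"
    using assms by (induction n) auto
  with Suc show ?case by simp
qed simp

lemma trajectory_restrict:
  assumes "\<phi> ` T \<subseteq> T" and "x \<in> T"
  shows "trajectory opr (restrict \<phi> T) n x = trajectory opr \<phi> n x"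
  by (induction n rule: induct_nat_012)
    (simp_all only: trajectory.simps One_nat_def funpow_restrict[OF assms])

text \<open>Closure is a bare hypothesis on a set, so that the lemma serves both for T and for the
  whole carrier S.\<close>

lemma trajectory_closed:
  assumes "\<And>x y. \<lbrakk>x \<in> T; y \<in> T\<rbrakk> \<Longrightarrow> opr x y \<in> T" and "\<phi> ` T \<subseteq> T" and "x \<in> T"
  shows "trajectory opr \<phi> n x \<in> T"
proof -
  have "(\<phi> ^^ k) x \<in> T" for k
    using assms(2,3) by (induction k) auto
  then show ?thesis
    by (induction n rule: induct_nat_012) (auto intro: assms simp del: funpow.simps)
qed

text \<open>The two sequences agree term by term: every trajectory, even the junk one at 0, lies in
  T, where \<open>restrict v T\<close> is v.\<close>

lemma entropy_at_restrict:
  assumes "\<And>x y. \<lbrakk>x \<in> T; y \<in> T\<rbrakk> \<Longrightarrow> opr x y \<in> T" and "\<phi> ` T \<subseteq> T" and "x \<in> T"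
  shows "entropy_at opr (restrict v T) (restrict \<phi> T) x = entropy_at opr v \<phi> x"
  using trajectory_closed[OF assms] assms
  by (simp add: entropy_at_def trajectory_restrict)

lemma (in preordered_semigroup) trajectory_mono:
  assumes "\<phi> ` S \<subseteq> S" and "monotone_on S le le \<phi>"
    and "x \<in> S" and "y \<in> S" and "le x y"
  shows "le (trajectory opr \<phi> n x) (trajectory opr \<phi> n y)"
proof -
  have closed: "(\<phi> ^^ k) z \<in> S" if "z \<in> S" for k z
    using assms(1) that by (induction k) auto
  have funpow_le: "le ((\<phi> ^^ k) x) ((\<phi> ^^ k) y)" for k
    using assms(2-5) closed by (induction k) (auto dest: monotone_onD)
  have traj: "trajectory opr \<phi> k z \<in> S" if "z \<in> S" for k z
    using trajectory_closed[OF mult_closed assms(1) that] .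
  show ?thesis
  proof (induction n rule: induct_nat_012)
    case (ge2 n)
    let ?t = "trajectory opr \<phi> (Suc n)" and ?p = "\<phi> ^^ Suc n"
    \<comment> \<open>The two factors are replaced one at a time, through the mixed product
      \<open>opr (?t y) (?p x)\<close>.\<close>
    have "le (opr (?t x) (?p x)) (opr (?t y) (?p x))"
      using ge2 traj closed assms by (intro mult_right_mono) auto
    moreover have "le (opr (?t y) (?p x)) (opr (?t y) (?p y))"
      using funpow_le traj closed assms by (intro mult_left_mono) blast+
    ultimately have "le (opr (?t x) (?p x)) (opr (?t y) (?p y))"
      \<comment> \<open>Transitivity holds only on S, so all three products must be shown to lie in
        S.\<close>
      by (rule transp_onD[OF le_trans, rotated 3])
        (use traj closed assms in \<open>auto intro!: mult_closed simp del: funpow.simps\<close>)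
    then show ?case by (simp del: funpow.simps)
  qed (use assms in auto)
qed

lemma (in preordered_semigroup) entropy_at_mono:
  assumes "\<phi> ` S \<subseteq> S" and "monotone_on S le le \<phi>" and "monotone_on S le (\<le>) v"
    and "x \<in> S" and "y \<in> S" and "le x y"
  shows "entropy_at opr v \<phi> x \<le> entropy_at opr v \<phi> y"
proof -
  have "v (trajectory opr \<phi> n x) \<le> v (trajectory opr \<phi> n y)" for n
    by (intro monotone_onD[OF assms(3)] trajectory_mono[OF assms(1,2,4-6)]
        trajectory_closed[where T = S] mult_closed assms)
  then show ?thesis
    unfolding entropy_at_def
    \<comment> \<open>The comparison holds for every n; at n = 0 both quotients are 0, since
      division by zero yields 0.\<close>
    by (intro Limsup_mono always_eventually allI ennreal_leI divide_right_mono) auto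
qed

theorem lemma3p7:
  fixes S T :: "'a set" and opr :: "'a \<Rightarrow> 'a \<Rightarrow> 'a" and v :: "'a \<Rightarrow> real" and \<phi> :: "'a \<Rightarrow> 'a"
  assumes "normed_semigroup S opr v"
    and "normed_semigroup_endo S opr v \<phi>"
    and "subsemigroup T S opr"
    and "\<phi> ` T \<subseteq> T"
  shows "semigroup_entropy S opr v \<phi> \<ge> semigroup_entropy T opr (restrict v T) (restrict \<phi> T)
    \<and> (\<forall>le. preordered_semigroup S opr le
          \<and> monotone_on S le le \<phi>
          \<and> monotone_on S le (\<le>) v
          \<and> cofinal_in le T S
        \<longrightarrow> semigroup_entropy S opr v \<phi> = semigroup_entropy T opr (restrict v T) (restrict \<phi> T))"
proof -
  have "T \<subseteq> S" and T_closed: "\<And>x y. \<lbrakk>x \<in> T; y \<in> T\<rbrakk> \<Longrightarrow> opr x y \<in> T"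
    using assms(3) by (auto simp: subsemigroup_def)
  have \<phi>S: "\<phi> ` S \<subseteq> S"
    using normed_semigroup_endo.endo_closed[OF assms(2)] by blast
  have restr: "semigroup_entropy T opr (restrict v T) (restrict \<phi> T)
      = (SUP x\<in>T. entropy_at opr v \<phi> x)"
    unfolding semigroup_entropy_def
    by (intro SUP_cong refl entropy_at_restrict T_closed assms(4))
  have le: "(SUP x\<in>T. entropy_at opr v \<phi> x) \<le> (SUP x\<in>S. entropy_at opr v \<phi> x)"
    by (rule SUP_subset_mono[OF \<open>T \<subseteq> S\<close>]) simp
  \<comment> \<open>Only this direction uses the order; with \<open>le\<close> it gives equality by
    antisymmetry.\<close>
  have "(SUP x\<in>S. entropy_at opr v \<phi> x) \<le> (SUP x\<in>T. entropy_at opr v \<phi> x)"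
    if mono: "preordered_semigroup S opr le" "monotone_on S le le \<phi>" "monotone_on S le (\<le>) v"
      "cofinal_in le T S" for le
  proof (rule SUP_mono)
    fix x assume "x \<in> S"
    then obtain t where "t \<in> T" "le x t"
      using mono(4) by (auto simp: cofinal_in_def)
    then show "\<exists>t\<in>T. entropy_at opr v \<phi> x \<le> entropy_at opr v \<phi> t"
      using preordered_semigroup.entropy_at_mono[OF mono(1) \<phi>S mono(2,3) \<open>x \<in> S\<close>] \<open>T \<subseteq> S\<close>
      by blast
  qed
  with le show ?thesis
    unfolding restr unfolding semigroup_entropy_def by (blast intro: antisym)
qed

end
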